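(* Let $\mathcal{B}=\{B_t\}_{t\in G}$ be a Fell bundle over a locally compact Hausdorff group $G$ and let $H$ be a closed subgroup of $G$. Then every representation of the reduction $\mathcal{B}_H$ is $\mathcal{B}$-positive.
   Context: A Fell bundle (C*-algebraic bundle) $\mathcal{B}=\{B_t\}_{t\in G}$ is a Banach *-algebraic bundle over $G$ in the sense of Fell–Doran with $\|b^*b\|=\|b\|^2$ and $b^*b\ge 0$ in the C*-algebra $B_e$ for all $b\in\mathcal{B}$ ($e$ the unit of $G$). For a closed subgroup $H\leqslant G$, $\mathcal{B}_H=\{B_t\}_{t\in H}$ is the reduction of $\mathcal B$ to $H$ with the inherited structure, and for a coset $rH$ we write $\mathcal{B}_{rH}=\bigcup_{t\in rH}B_t$. A representation of $\mathcal{B}_H$ is a *-representation $S:\mathcal{B}_H\to\mathbb{B}(X)$ on a Hilbert space. Such $S$ is called $\mathcal{B}$-positive if for every coset $rH\in G/H$, every integer $n>0$, all $b_1,\dots,b_n\in\mathcal{B}_{rH}$ and all $\xi_1,\dots,\xi_n\in X$ one has $\sum_{i,j=1}^n\langle S_{b_j^*b_i}\xi_i,\xi_j\rangle\ge 0$ (note $b_j^*b_i\in\mathcal{B}_H$). *)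

theory Defs
  imports "HOL-Analysis.Analysis" "HOL-Library.Complex_Order"
begin

text \<open>The group G is a type of class topological_group_add (written additively,
  NOT assumed commutative: unit 0 is e, + is the group product, uminus is inversion).
  A bundle over G is given by a type 'b of bundle elements (the total space, carrying
  its topology via the class topological_space) together with the structure maps below.
  For t in G the fibre is B_t = {b. proj b = t}; fibre operations are only meaningful
  on elements of the same fibre.\<close>

record ('g, 'b) bundle_ops =
  proj  :: "'b \<Rightarrow> 'g"                 
  badd  :: "'b \<Rightarrow> 'b \<Rightarrow> 'b"
  bzero :: "'g \<Rightarrow> 'b"
  bsmul :: "complex \<Rightarrow> 'b \<Rightarrow> 'b"
  bnorm :: "'b \<Rightarrow> real"
  bmult :: "'b \<Rightarrow> 'b \<Rightarrow> 'b"
  bstar :: "'b \<Rightarrow> 'b"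

definition fibre :: "('g, 'b) bundle_ops \<Rightarrow> 'g \<Rightarrow> 'b set" where
  "fibre B t = {b. proj B b = t}"

definition banach_fibres :: "('g, 'b) bundle_ops \<Rightarrow> bool" where
  "banach_fibres B \<longleftrightarrow>
     (\<forall>t. proj B (bzero B t) = t) \<and>
     (\<forall>b c. proj B b = proj B c \<longrightarrow> proj B (badd B b c) = proj B b) \<and>
     (\<forall>a b. proj B (bsmul B a b) = proj B b) \<and>
     (\<forall>b c d. proj B b = proj B c \<and> proj B c = proj B d \<longrightarrow>
        badd B (badd B b c) d = badd B b (badd B c d)) \<and>
     (\<forall>b c. proj B b = proj B c \<longrightarrow> badd B b c = badd B c b) \<and>
     (\<forall>b. badd B b (bzero B (proj B b)) = b) \<and>
     (\<forall>b. badd B b (bsmul B (-1) b) = bzero B (proj B b)) \<and>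
     (\<forall>b. bsmul B 1 b = b) \<and>
     (\<forall>a c b. bsmul B a (bsmul B c b) = bsmul B (a * c) b) \<and>
     (\<forall>a c b. bsmul B (a + c) b = badd B (bsmul B a b) (bsmul B c b)) \<and>
     (\<forall>a b c. proj B b = proj B c \<longrightarrow>
        bsmul B a (badd B b c) = badd B (bsmul B a b) (bsmul B a c)) \<and>
     (\<forall>b. bnorm B b \<ge> 0) \<and>
     (\<forall>b. bnorm B b = 0 \<longleftrightarrow> b = bzero B (proj B b)) \<and>
     (\<forall>a b. bnorm B (bsmul B a b) = cmod a * bnorm B b) \<and>
     (\<forall>b c. proj B b = proj B c \<longrightarrow> bnorm B (badd B b c) \<le> bnorm B b + bnorm B c) \<and>
     (\<forall>t f. (\<forall>n. proj B (f n) = t) \<longrightarrow>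
        (\<forall>e>0. \<exists>N. \<forall>m\<ge>N. \<forall>n\<ge>N. bnorm B (badd B (f m) (bsmul B (-1) (f n))) < e) \<longrightarrow>
        (\<exists>b. proj B b = t \<and> (\<lambda>n. bnorm B (badd B (f n) (bsmul B (-1) b))) \<longlonglongrightarrow> 0))"

text \<open>Topological axioms of a Banach bundle (Fell--Doran II.13.4) together with continuity
  of multiplication and involution (Fell--Doran VIII.2.2, VIII.3.1).\<close>
definition bundle_topology ::
  "('g::topological_space, 'b::topological_space) bundle_ops \<Rightarrow> bool" where
  "bundle_topology B \<longleftrightarrow>
     surj (proj B) \<and> continuous_on UNIV (proj B) \<and> (\<forall>U. open U \<longrightarrow> open (proj B ` U)) \<and>
     continuous_on UNIV (bnorm B) \<and>
     continuous_on {(b, c). proj B b = proj B c} (\<lambda>(b, c). badd B b c) \<and>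
     (\<forall>a. continuous_on UNIV (bsmul B a)) \<and>
     (\<forall>(F :: 'b filter) (f :: 'b \<Rightarrow> 'b) t.
        ((\<lambda>x. bnorm B (f x)) \<longlongrightarrow> 0) F \<longrightarrow> ((\<lambda>x. proj B (f x)) \<longlongrightarrow> t) F \<longrightarrow>
        (f \<longlongrightarrow> bzero B t) F) \<and>
     continuous_on UNIV (\<lambda>(b, c). bmult B b c) \<and>
     continuous_on UNIV (bstar B)"

definition star_algebraic ::
  "('g::group_add, 'b) bundle_ops \<Rightarrow> bool" where
  "star_algebraic B \<longleftrightarrow>
     (\<forall>b c. proj B (bmult B b c) = proj B b + proj B c) \<and>
     (\<forall>b c d. proj B b = proj B c \<longrightarrow>
        bmult B (badd B b c) d = badd B (bmult B b d) (bmult B c d)) \<and>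
     (\<forall>b c d. proj B b = proj B c \<longrightarrow>
        bmult B d (badd B b c) = badd B (bmult B d b) (bmult B d c)) \<and>
     (\<forall>a b c. bmult B (bsmul B a b) c = bsmul B a (bmult B b c)) \<and>
     (\<forall>a b c. bmult B b (bsmul B a c) = bsmul B a (bmult B b c)) \<and>
     (\<forall>b c d. bmult B (bmult B b c) d = bmult B b (bmult B c d)) \<and>
     (\<forall>b c. bnorm B (bmult B b c) \<le> bnorm B b * bnorm B c) \<and>
     (\<forall>b. proj B (bstar B b) = - proj B b) \<and>
     (\<forall>b c. proj B b = proj B c \<longrightarrow> bstar B (badd B b c) = badd B (bstar B b) (bstar B c)) \<and>
     (\<forall>a b. bstar B (bsmul B a b) = bsmul B (cnj a) (bstar B b)) \<and>
     (\<forall>b. bstar B (bstar B b) = b) \<and>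
     (\<forall>b c. bstar B (bmult B b c) = bmult B (bstar B c) (bstar B b)) \<and>
     (\<forall>b. bnorm B (bstar B b) = bnorm B b)"

text \<open>Spectrum of an element a of the unit fibre B_e (a C*-algebra, possibly non-unital),
  computed in the unitization: 0 is always in it, and for mu \<noteq> 0, mu is in the spectrum
  iff a - mu 1 is not invertible in the unitization, i.e. there is no c in B_e with
  (a - mu 1)(c - mu^-1 1) = 1 = (c - mu^-1 1)(a - mu 1).\<close>
definition unit_fibre_spectrum :: "('g::group_add, 'b) bundle_ops \<Rightarrow> 'b \<Rightarrow> complex set" where
  "unit_fibre_spectrum B a = {0} \<union> {\<mu>. \<mu> \<noteq> 0 \<and> \<not> (\<exists>c. proj B c = 0 \<and>
      badd B (badd B (bmult B a c) (bsmul B (- inverse \<mu>) a)) (bsmul B (- \<mu>) c) = bzero B 0 \<and>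
      badd B (badd B (bmult B c a) (bsmul B (- inverse \<mu>) a)) (bsmul B (- \<mu>) c) = bzero B 0)}"

definition unit_fibre_positive :: "('g::group_add, 'b) bundle_ops \<Rightarrow> 'b \<Rightarrow> bool" where
  "unit_fibre_positive B a \<longleftrightarrow> proj B a = 0 \<and> bstar B a = a \<and>
     (\<forall>\<mu> \<in> unit_fibre_spectrum B a. 0 \<le> \<mu>)"

definition fell_bundle ::
  "('g::{topological_group_add}, 'b::topological_space) bundle_ops \<Rightarrow> bool" where
  "fell_bundle B \<longleftrightarrow> banach_fibres B \<and> bundle_topology B \<and> star_algebraic B \<and>
     (\<forall>b. bnorm B (bmult B (bstar B b) b) = (bnorm B b)\<^sup>2) \<and>
     (\<forall>b. unit_fibre_positive B (bmult B (bstar B b) b))"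

definition hnorm :: "('x \<Rightarrow> 'x \<Rightarrow> complex) \<Rightarrow> 'x \<Rightarrow> real" where
  "hnorm ip x = sqrt (Re (ip x x))"

definition hilbert_space ::
  "(complex \<Rightarrow> 'x::ab_group_add \<Rightarrow> 'x) \<Rightarrow> ('x \<Rightarrow> 'x \<Rightarrow> complex) \<Rightarrow> bool" where
  "hilbert_space hsmul ip \<longleftrightarrow>
     (\<forall>x. hsmul 1 x = x) \<and>
     (\<forall>a b x. hsmul a (hsmul b x) = hsmul (a * b) x) \<and>
     (\<forall>a b x. hsmul (a + b) x = hsmul a x + hsmul b x) \<and>
     (\<forall>a x y. hsmul a (x + y) = hsmul a x + hsmul a y) \<and>
     (\<forall>x y z. ip (x + y) z = ip x z + ip y z) \<and>
     (\<forall>a x y. ip (hsmul a x) y = a * ip x y) \<and>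
     (\<forall>x y. ip y x = cnj (ip x y)) \<and>
     (\<forall>x. 0 \<le> ip x x) \<and>
     (\<forall>x. ip x x = 0 \<longrightarrow> x = 0) \<and>
     (\<forall>f :: nat \<Rightarrow> 'x. (\<forall>e>0. \<exists>N. \<forall>m\<ge>N. \<forall>n\<ge>N. hnorm ip (f m - f n) < e) \<longrightarrow>
        (\<exists>x. (\<lambda>n. hnorm ip (f n - x)) \<longlonglongrightarrow> 0))"

definition bounded_op ::
  "(complex \<Rightarrow> 'x::ab_group_add \<Rightarrow> 'x) \<Rightarrow> ('x \<Rightarrow> 'x \<Rightarrow> complex) \<Rightarrow> ('x \<Rightarrow> 'x) \<Rightarrow> bool" where
  "bounded_op hsmul ip T \<longleftrightarrow>
     (\<forall>x y. T (x + y) = T x + T y) \<and> (\<forall>a x. T (hsmul a x) = hsmul a (T x)) \<and>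
     (\<exists>C. \<forall>x. hnorm ip (T x) \<le> C * hnorm ip x)"

definition closed_subgroup :: "'g::topological_group_add set \<Rightarrow> bool" where
  "closed_subgroup H \<longleftrightarrow> closed H \<and> 0 \<in> H \<and> (\<forall>x\<in>H. \<forall>y\<in>H. x + y \<in> H) \<and> (\<forall>x\<in>H. - x \<in> H)"

text \<open>A *-representation of the reduction B_H = {b. proj b \<in> H} on the Hilbert space
  (hsmul, ip): S is only constrained on B_H, with values in B(X).\<close>
definition reduction_rep ::
  "('g::group_add, 'b) bundle_ops \<Rightarrow> 'g set \<Rightarrow> (complex \<Rightarrow> 'x::ab_group_add \<Rightarrow> 'x) \<Rightarrow>
   ('x \<Rightarrow> 'x \<Rightarrow> complex) \<Rightarrow> ('b \<Rightarrow> 'x \<Rightarrow> 'x) \<Rightarrow> bool" where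
  "reduction_rep B H hsmul ip S \<longleftrightarrow>
     (\<forall>b. proj B b \<in> H \<longrightarrow> bounded_op hsmul ip (S b)) \<and>
     (\<forall>b c. proj B b \<in> H \<longrightarrow> proj B c = proj B b \<longrightarrow> S (badd B b c) = (\<lambda>x. S b x + S c x)) \<and>
     (\<forall>a b. proj B b \<in> H \<longrightarrow> S (bsmul B a b) = (\<lambda>x. hsmul a (S b x))) \<and>
     (\<forall>b c. proj B b \<in> H \<longrightarrow> proj B c \<in> H \<longrightarrow> S (bmult B b c) = S b \<circ> S c) \<and>
     (\<forall>b x y. proj B b \<in> H \<longrightarrow> ip (S (bstar B b) x) y = ip x (S b y))"

text \<open>B-positivity; cosets rH are written additively as (+) r ` H.\<close>
definition B_positive ::
  "('g::group_add, 'b) bundle_ops \<Rightarrow> 'g set \<Rightarrow> ('x \<Rightarrow> 'x \<Rightarrow> complex) \<Rightarrow> ('b \<Rightarrow> 'x \<Rightarrow> 'x) \<Rightarrow> bool" where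
  "B_positive B H ip S \<longleftrightarrow>
     (\<forall>r (n::nat) (b :: nat \<Rightarrow> 'b) (\<xi> :: nat \<Rightarrow> 'x). 0 < n \<longrightarrow>
        (\<forall>i<n. proj B (b i) \<in> (+) r ` H) \<longrightarrow>
        0 \<le> (\<Sum>i<n. \<Sum>j<n. ip (S (bmult B (bstar B (b j)) (b i)) (\<xi> i)) (\<xi> j)))"

end

theory Submission
  imports Defs
begin

text \<open>For a pivot \<open>p\<close> among the \<open>b\<^sub>i\<close> put \<open>a = p\<^sup>* p\<close>, \<open>y\<^sub>i = (a + \<mu>)\<^sup>-\<^sup>1 p\<^sup>* b\<^sub>i\<close> and
  \<open>z\<^sub>i = b\<^sub>i - p y\<^sub>i\<close>, where \<open>\<mu> > 0\<close>. Then \<open>y\<^sub>i\<close> lies over \<open>H\<close>, \<open>z\<^sub>i\<close> lies over \<open>r H\<close> and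
  \<open>p\<^sup>* z\<^sub>i = \<mu> y\<^sub>i\<close>. With \<open>w = \<Sum> S(y\<^sub>i) \<xi>\<^sub>i\<close>, the form of the \<open>b\<^sub>i\<close> and \<open>p\<close> equals
  \<open>\<langle>S(a) (\<xi> + w), \<xi> + w\<rangle> + \<mu> (2 \<langle>w, w\<rangle> + 2 Re \<langle>w, \<xi>\<rangle>)\<close> plus the form of the \<open>z\<^sub>i\<close>.
  The latter is nonnegative by induction on the number of elements and the middle term is at
  least \<open>-(\<mu>/2) \<langle>\<xi>, \<xi>\<rangle>\<close>, so \<open>\<mu> \<rightarrow> 0\<close> gives the claim. That \<open>S(a) \<ge> 0\<close> follows from the
  spectrum of \<open>a\<close>, because \<open>S(a) + \<mu>\<close> has a bounded inverse for every \<open>\<mu> > 0\<close>.\<close>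

section \<open>Hermitian forms and a positivity criterion for bounded operators\<close>

locale hilbert =
  fixes hsmul :: "complex \<Rightarrow> 'x::ab_group_add \<Rightarrow> 'x"
    and ip :: "'x \<Rightarrow> 'x \<Rightarrow> complex"
  assumes hilbert: "hilbert_space hsmul ip"
begin

lemma ip_add_left: "ip (x + y) z = ip x z + ip y z"
  and ip_smul_left: "ip (hsmul a x) y = a * ip x y"
  and ip_cnj: "ip y x = cnj (ip x y)"
  and ip_ge_0: "0 \<le> ip x x"
  using hilbert unfolding hilbert_space_def by meson+

lemma ip_add_right: "ip z (x + y) = ip z x + ip z y"
  using ip_cnj[of z "x + y"] ip_cnj[of z x] ip_cnj[of z y] by (simp add: ip_add_left)

lemma ip_smul_right: "ip x (hsmul a y) = cnj a * ip x y"
  using ip_cnj[of x "hsmul a y"] ip_cnj[of x y] by (simp add: ip_smul_left)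

lemma ip_zero_left [simp]: "ip 0 z = 0"
  using ip_add_left[of 0 0 z] by simp

lemma ip_zero_right [simp]: "ip z 0 = 0"
  using ip_add_right[of z 0 0] by simp

lemma ip_sum_left: "ip (sum f A) z = (\<Sum>i\<in>A. ip (f i) z)"
  by (induction A rule: infinite_finite_induct) (auto simp: ip_add_left)

lemma ip_sum_right: "ip z (sum f A) = (\<Sum>i\<in>A. ip z (f i))"
  by (induction A rule: infinite_finite_induct) (auto simp: ip_add_right)

lemma ip_sum_sum: "ip (sum f A) (sum g C) = (\<Sum>i\<in>A. \<Sum>j\<in>C. ip (f i) (g j))"
  by (simp add: ip_sum_left) (simp add: ip_sum_right)

lemma Re_ip_ge_0: "0 \<le> Re (ip x x)"
  using ip_ge_0[of x] by (simp add: less_eq_complex_def)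

lemma Re_ip_commute: "Re (ip y x) = Re (ip x y)"
  by (subst ip_cnj) simp

text \<open>Nonnegativity of this quadratic polynomial in \<open>s\<close> supplies the estimates
  for which Cauchy-Schwarz would otherwise be used.\<close>

lemma Re_ip_add_smul:
  "Re (ip (x + hsmul (of_real s) y) (x + hsmul (of_real s) y))
    = Re (ip x x) + 2 * s * Re (ip x y) + s\<^sup>2 * Re (ip y y)"
  by (simp add: ip_add_left ip_add_right ip_smul_left ip_smul_right Re_ip_commute[of y x]
      power2_eq_square algebra_simps)

lemma hnorm_power2: "(hnorm ip x)\<^sup>2 = Re (ip x x)"
  unfolding hnorm_def using Re_ip_ge_0 by simp

lemma hnorm_ge_0: "0 \<le> hnorm ip x"
  unfolding hnorm_def using Re_ip_ge_0 by simp

lemma bounded_op_Re_ip: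
  assumes "bounded_op hsmul ip T"
  shows "\<exists>C\<ge>0. \<forall>x. Re (ip (T x) (T x)) \<le> C * Re (ip x x)"
proof -
  obtain C where C: "\<And>x. hnorm ip (T x) \<le> C * hnorm ip x"
    using assms unfolding bounded_op_def by blast
  have "Re (ip (T x) (T x)) \<le> C\<^sup>2 * Re (ip x x)" for x
    using power_mono[OF C[of x], of 2]
    by (simp add: hnorm_ge_0 hnorm_power2 power_mult_distrib)
  then show ?thesis by (intro exI[of _ "C\<^sup>2"]) auto
qed

text \<open>Let \<open>m\<close> be the least shift at least 0 for which \<open>T + m\<close> is
  nonnegative. If \<open>m > 0\<close>, then \<open>T + m\<close> is nonnegative and bounded below,
  hence bounded below as a form, so a smaller shift would still do.\<close>

lemma nonneg_if_bounded_below: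
  assumes T: "bounded_op hsmul ip T"
    and sym: "\<And>x y. ip (T x) y = ip x (T y)"
    and below: "\<And>m. 0 < (m::real) \<Longrightarrow>
      \<exists>K. \<forall>x. Re (ip x x) \<le> K * Re (ip (T x + hsmul (of_real m) x) (T x + hsmul (of_real m) x))"
  shows "0 \<le> ip (T x) x"
proof -
  define q where "q x = Re (ip x x)" for x
  define f where "f x = Re (ip (T x) x)" for x
  have q0: "q x \<ge> 0" for x unfolding q_def by (rule Re_ip_ge_0)
  have lin: "T (x + hsmul a y) = T x + hsmul a (T y)" for a x y
    using T unfolding bounded_op_def by simp
  obtain C where C: "C \<ge> 0" "\<And>x. q (T x) \<le> C * q x"
    using bounded_op_Re_ip[OF T] unfolding q_def by blast
  define M where "M = C + 1"
  \<comment> \<open>Expand the squared norms of \<open>T x + x\<close> and \<open>T x - x\<close>,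
    both nonnegative.\<close>
  have M: "\<bar>f x\<bar> \<le> M * q x" for x
    using Re_ip_add_smul[of "T x" 1 x] Re_ip_add_smul[of "T x" "-1" x] C(2)[of x] q0[of x]
      Re_ip_ge_0[of "T x + hsmul (of_real 1) x"] Re_ip_ge_0[of "T x + hsmul (of_real (-1)) x"]
    unfolding M_def f_def q_def by (simp add: algebra_simps abs_le_iff)
  define A where "A = {m::real. 0 \<le> m \<and> (\<forall>x. 0 \<le> f x + m * q x)}"
  have "closed A"
    unfolding A_def
    by (intro closed_Collect_conj closed_Collect_all closed_Collect_le continuous_intros)
  moreover have "0 \<le> f x + M * q x" for x
    using M[of x] by (simp add: abs_le_iff)
  then have "M \<in> A"
    using C(1) unfolding A_def M_def by simp
  moreover have bdd: "bdd_below A" unfolding A_def by (auto intro!: bdd_belowI[of _ 0])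
  ultimately have InfA: "Inf A \<in> A" by (intro closed_contains_Inf) auto
  define m where "m = Inf A"
  have m: "m \<ge> 0" "\<And>x. 0 \<le> f x + m * q x" using InfA unfolding m_def A_def by auto
  have "m = 0"
  proof (rule ccontr)
    assume "m \<noteq> 0"
    then have "m > 0" using m(1) by simp
    define P where "P x = T x + hsmul m x" for x
    obtain K0 where K0: "\<And>x. q x \<le> K0 * q (P x)"
      using below[OF \<open>m > 0\<close>] unfolding q_def P_def by blast
    define K where "K = max K0 1"
    have K: "K > 0" "\<And>x. q x \<le> K * q (P x)"
    proof -
      show "K > 0" unfolding K_def by simp
      show "q x \<le> K * q (P x)" for x
        using K0[of x] mult_right_mono[OF _ q0, of K0 K "P x"] unfolding K_def by simp
    qed
    define D where "D = M + m"
    have D: "D > 0" using \<open>m > 0\<close> C(1) unfolding D_def M_def by simp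
    \<comment> \<open>This is the estimate of the squared norm of \<open>P x\<close> by
      \<open>D\<close> times the form of \<open>P\<close>. It comes from evaluating the nonnegative
      form of \<open>P\<close> at \<open>x - P x / D\<close>; the step \<open>- 1 / D\<close>
      minimizes the upper bound obtained from \<open>M\<close>.\<close>
    have qP: "q (P x) \<le> D * (f x + m * q x)" for x
    proof -
      define z where "z = P x"
      define s where "s = - 1 / D"
      define y where "y = x + hsmul (of_real s) z"
      have "f y = f x + 2 * s * Re (ip (T x) z) + s\<^sup>2 * f z"
        unfolding f_def y_def lin
        by (simp add: ip_add_left ip_add_right ip_smul_left ip_smul_right sym[of z x]
            Re_ip_commute[of "T x" z] power2_eq_square algebra_simps)
      moreover have "q y = q x + 2 * s * Re (ip x z) + s\<^sup>2 * q z"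
        unfolding q_def y_def by (rule Re_ip_add_smul)
      moreover have "ip (P x) z = ip (T x) z + m * ip x z"
        unfolding P_def by (simp add: ip_add_left ip_smul_left)
      then have "q z = Re (ip (T x) z) + m * Re (ip x z)"
        by (simp add: q_def flip: z_def)
      ultimately have "f y + m * q y = (f x + m * q x) + 2 * s * q z + s\<^sup>2 * (f z + m * q z)"
        by (simp only:) (simp add: algebra_simps)
      also have "\<dots> \<le> (f x + m * q x) + 2 * s * q z + s\<^sup>2 * (D * q z)"
        using M[of z] unfolding D_def by (intro add_left_mono mult_left_mono) (auto simp: algebra_simps)
      also have "\<dots> = (f x + m * q x) - q z / D"
        using D unfolding s_def by (simp add: power2_eq_square)
      finally have "q z / D \<le> f x + m * q x" using m(2)[of y] by simp
      then show ?thesis using D unfolding z_def by (simp add: field_simps)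
    qed
    \<comment> \<open>Chaining \<open>K\<close> and \<open>qP\<close> gives
      \<open>d * q x \<le> f x + m * q x\<close>, so the shift can be lowered by
      \<open>d\<close>.\<close>
    define d where "d = 1 / (K * D)"
    have d: "d > 0" using K(1) D unfolding d_def by simp
    have "0 \<le> f x + (m - d) * q x" for x
    proof -
      have "q x \<le> K * (D * (f x + m * q x))"
        using K(1) by (intro order_trans[OF K(2)] mult_left_mono qP) simp
      then show ?thesis using K(1) D unfolding d_def by (simp add: field_simps)
    qed
    \<comment> \<open>The set \<open>A\<close> contains only nonnegative shifts, while
      \<open>m - d\<close> may be negative.\<close>
    moreover have "f x + (m - d) * q x \<le> f x + max 0 (m - d) * q x" for x
      using q0 by (intro add_left_mono mult_right_mono) auto
    ultimately have "0 \<le> f x + max 0 (m - d) * q x" for x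
      by (rule order_trans)
    then have "max 0 (m - d) \<in> A" unfolding A_def by simp
    then have "m \<le> max 0 (m - d)" unfolding m_def using bdd by (rule cInf_lower)
    then show False using d \<open>m > 0\<close> by simp
  qed
  then have "0 \<le> Re (ip (T x) x)" using m(2)[of x] unfolding f_def by simp
  moreover have "Im (ip (T x) x) = 0"
    using ip_cnj[of "T x" x] by (simp add: sym complex_eq_iff)
  ultimately show ?thesis by (simp add: less_eq_complex_def)
qed

end

section \<open>Fibrewise algebra of the bundle and the representation of its reduction\<close>

locale fell_rep = hilbert hsmul ip
  for hsmul :: "complex \<Rightarrow> 'x::ab_group_add \<Rightarrow> 'x" and ip :: "'x \<Rightarrow> 'x \<Rightarrow> complex" +
  fixes B :: "('g::topological_group_add, 'b::topological_space) bundle_ops"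
    and H :: "'g set" and S :: "'b \<Rightarrow> 'x \<Rightarrow> 'x"
  assumes fell: "fell_bundle B"
    and subgroup: "closed_subgroup H"
    and rep: "reduction_rep B H hsmul ip S"
begin

abbreviation mult (infixl "\<cdot>" 70) where "b \<cdot> c \<equiv> bmult B b c"
abbreviation star ("_\<^sup>\<star>" [1000] 1000) where "b\<^sup>\<star> \<equiv> bstar B b"

definition diff where "diff b c = badd B b (bsmul B (-1) c)"

lemma proj_simps [simp]:
  "proj B (b \<cdot> c) = proj B b + proj B c"
  "proj B (b\<^sup>\<star>) = - proj B b"
  "proj B (bsmul B s b) = proj B b"
  "proj B b = proj B c \<Longrightarrow> proj B (badd B b c) = proj B b"
  "proj B b = proj B c \<Longrightarrow> proj B (diff b c) = proj B b"
  using fell unfolding fell_bundle_def banach_fibres_def star_algebraic_def diff_def by auto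

lemma mult_assoc: "(b \<cdot> c) \<cdot> d = b \<cdot> (c \<cdot> d)"
  and star_mult: "(b \<cdot> c)\<^sup>\<star> = c\<^sup>\<star> \<cdot> b\<^sup>\<star>"
  and star_star [simp]: "b\<^sup>\<star>\<^sup>\<star> = b"
  using fell unfolding fell_bundle_def star_algebraic_def by simp_all

lemma diff_mult: "proj B b = proj B c \<Longrightarrow> diff b c \<cdot> d = diff (b \<cdot> d) (c \<cdot> d)"
  and mult_diff: "proj B b = proj B c \<Longrightarrow> d \<cdot> diff b c = diff (d \<cdot> b) (d \<cdot> c)"
  and star_diff: "proj B b = proj B c \<Longrightarrow> (diff b c)\<^sup>\<star> = diff (b\<^sup>\<star>) (c\<^sup>\<star>)"
  using fell unfolding fell_bundle_def banach_fibres_def star_algebraic_def diff_def by simp_all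

lemma subgroup_simps: "0 \<in> H" "x \<in> H \<Longrightarrow> y \<in> H \<Longrightarrow> x + y \<in> H" "x \<in> H \<Longrightarrow> - x \<in> H"
  using subgroup unfolding closed_subgroup_def by auto

text \<open>For \<open>s = r + h\<close> and \<open>t = r + k\<close> the representative cancels and
  leaves \<open>- h + k\<close>. The order matters, as the group need not be commutative.\<close>

lemma coset_diff:
  assumes "s \<in> (+) r ` H" "t \<in> (+) r ` H"
  shows "- s + t \<in> H"
proof -
  obtain h k where "h \<in> H" "s = r + h" "k \<in> H" "t = r + k" using assms by blast
  then show ?thesis
    by (simp only: minus_add add.assoc minus_add_cancel subgroup_simps)
qed

lemma S_bounded: "proj B b \<in> H \<Longrightarrow> bounded_op hsmul ip (S b)"
  and S_badd: "proj B b \<in> H \<Longrightarrow> proj B c = proj B b \<Longrightarrow> S (badd B b c) x = S b x + S c x"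
  and S_bsmul: "proj B b \<in> H \<Longrightarrow> S (bsmul B s b) x = hsmul s (S b x)"
  and S_mult: "proj B b \<in> H \<Longrightarrow> proj B c \<in> H \<Longrightarrow> S (b \<cdot> c) x = S b (S c x)"
  and S_star: "proj B b \<in> H \<Longrightarrow> ip (S (b\<^sup>\<star>) x) y = ip x (S b y)"
  using rep unfolding reduction_rep_def by auto

lemma S_add: "proj B b \<in> H \<Longrightarrow> S b (x + y) = S b x + S b y"
  and S_smul: "proj B b \<in> H \<Longrightarrow> S b (hsmul s x) = hsmul s (S b x)"
  using S_bounded unfolding bounded_op_def by meson+

lemma S_zero: "proj B b \<in> H \<Longrightarrow> S b 0 = 0"
  using S_add[of b 0 0] by simp

lemma S_sum: "proj B b \<in> H \<Longrightarrow> S b (sum f A) = (\<Sum>i\<in>A. S b (f i))"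
  by (induction A rule: infinite_finite_induct) (auto simp: S_add S_zero)

lemma ip_S_diff:
  assumes "proj B b \<in> H" "proj B c = proj B b"
  shows "ip (S (diff b c) x) y = ip (S b x) y - ip (S c x) y"
  using assms by (simp add: diff_def S_badd S_bsmul ip_add_left ip_smul_left)

lemma smul_add: "hsmul a (x + y) = hsmul a x + hsmul a y"
  and smul_smul: "hsmul a (hsmul b x) = hsmul (a * b) x"
  and smul_one [simp]: "hsmul 1 x = x"
  using hilbert unfolding hilbert_space_def by meson+

section \<open>Resolvents in the unit fibre and positivity of
  \<open>S (b\<^sup>\<star> \<cdot> b)\<close>\<close>

lemma S_bzero: "S (bzero B 0) x = 0"
proof -
  have "proj B (bzero B 0) = 0" "badd B (bzero B 0) (bzero B 0) = bzero B 0"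
    using fell unfolding fell_bundle_def banach_fibres_def by metis+
  then show ?thesis using S_badd[of "bzero B 0" "bzero B 0" x] subgroup_simps(1) by simp
qed

text \<open>Positivity of \<open>a = b\<^sup>\<star> \<cdot> b\<close> keeps \<open>- \<mu>\<close>
  out of its spectrum, so \<open>a + \<mu>\<close> has an inverse \<open>e + 1 / \<mu>\<close> in
  the unitization. The two equations are the images under \<open>S\<close> of the inverse relations
  with the unit cancelled; they hold even if \<open>S\<close> is degenerate.\<close>

lemma resolvent:
  fixes \<mu> :: real
  assumes "\<mu> > 0"
  obtains e where "proj B e = 0"
    and "\<And>x. S (b\<^sup>\<star> \<cdot> b) (S e x) + hsmul (1 / \<mu>) (S (b\<^sup>\<star> \<cdot> b) x) + hsmul \<mu> (S e x) = 0"
    and "\<And>x. S e (S (b\<^sup>\<star> \<cdot> b) x) + hsmul (1 / \<mu>) (S (b\<^sup>\<star> \<cdot> b) x) + hsmul \<mu> (S e x) = 0"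
proof -
  define a where "a = b\<^sup>\<star> \<cdot> b"
  have a: "proj B a = 0" unfolding a_def by simp
  have "\<not> 0 \<le> - complex_of_real \<mu>" using assms by (simp add: less_eq_complex_def)
  moreover have "unit_fibre_positive B a"
    using fell unfolding fell_bundle_def a_def by blast
  ultimately have "- complex_of_real \<mu> \<notin> unit_fibre_spectrum B a"
    unfolding unit_fibre_positive_def by blast
  then obtain e where e: "proj B e = 0"
    "badd B (badd B (a \<cdot> e) (bsmul B (1 / \<mu>) a)) (bsmul B \<mu> e) = bzero B 0"
    "badd B (badd B (e \<cdot> a) (bsmul B (1 / \<mu>) a)) (bsmul B \<mu> e) = bzero B 0"
    using assms unfolding unit_fibre_spectrum_def by (auto simp: inverse_eq_divide)
  show thesis
  proof (rule that[OF e(1)])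
    fix x
    show "S (b\<^sup>\<star> \<cdot> b) (S e x) + hsmul (1 / \<mu>) (S (b\<^sup>\<star> \<cdot> b) x) + hsmul \<mu> (S e x) = 0"
      using S_bzero[of x] a e(1) subgroup_simps(1)
      by (simp flip: e(2) a_def add: S_badd S_bsmul S_mult)
    show "S e (S (b\<^sup>\<star> \<cdot> b) x) + hsmul (1 / \<mu>) (S (b\<^sup>\<star> \<cdot> b) x) + hsmul \<mu> (S e x) = 0"
      using S_bzero[of x] a e(1) subgroup_simps(1)
      by (simp flip: e(3) a_def add: S_badd S_bsmul S_mult)
  qed
qed

text \<open>The element \<open>b\<close> may lie outside the reduction, so this cannot be read off
  as the squared norm of \<open>S b x\<close>. Only \<open>b\<^sup>\<star> \<cdot> b\<close>, which
  lies over 0, is sure to be represented; its resolvents give the lower bounds that the criterion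
  asks for.\<close>

lemma S_star_mult_nonneg: "0 \<le> ip (S (b\<^sup>\<star> \<cdot> b) x) x"
proof (rule nonneg_if_bounded_below)
  have a: "proj B (b\<^sup>\<star> \<cdot> b) \<in> H" by (simp add: subgroup_simps)
  then show "bounded_op hsmul ip (S (b\<^sup>\<star> \<cdot> b))" by (rule S_bounded)
  show "ip (S (b\<^sup>\<star> \<cdot> b) x) y = ip x (S (b\<^sup>\<star> \<cdot> b) y)" for x y
    using S_star[OF a] by (simp add: star_mult)
  fix m :: real assume m: "m > 0"
  obtain e where e: "proj B e = 0"
    "\<And>x. S e (S (b\<^sup>\<star> \<cdot> b) x) + hsmul (1 / m) (S (b\<^sup>\<star> \<cdot> b) x) + hsmul m (S e x) = 0"
    using resolvent[OF m, of b] by metis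
  then have eH: "proj B e \<in> H" by (simp add: subgroup_simps)
  obtain C where C: "C \<ge> 0" "\<And>x. Re (ip (S e x) (S e x)) \<le> C * Re (ip x x)"
    using bounded_op_Re_ip[OF S_bounded[OF eH]] by blast
  \<comment> \<open>With \<open>y = (S a + m) x\<close>, where
    \<open>a = b\<^sup>\<star> \<cdot> b\<close>, the resolvent gives
    \<open>x = S e y + y / m\<close>. The constant then comes from bounding the squared norm of a
    sum of two vectors by twice the sum of their squared norms.\<close>
  have "Re (ip x x) \<le> (2 * C + 2 / m\<^sup>2) *
      Re (ip (S (b\<^sup>\<star> \<cdot> b) x + hsmul m x) (S (b\<^sup>\<star> \<cdot> b) x + hsmul m x))" for x
  proof -
    define y where "y = S (b\<^sup>\<star> \<cdot> b) x + hsmul m x"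
    have "S e y + hsmul (1 / m) y = x"
      using e(2)[of x] m eH unfolding y_def
      by (simp add: S_add S_smul smul_add smul_smul algebra_simps)
    then have x: "x = S e y + hsmul (of_real (1 / m)) y" by simp
    have "Re (ip x x) \<le> 2 * Re (ip (S e y) (S e y)) + 2 * (1 / m)\<^sup>2 * Re (ip y y)"
      using Re_ip_ge_0[of "S e y + hsmul (of_real (- (1 / m))) y"]
      unfolding x Re_ip_add_smul by (simp add: algebra_simps)
    then show ?thesis using C(2)[of y] unfolding y_def[symmetric]
      by (simp add: algebra_simps power_divide)
  qed
  then show "\<exists>K. \<forall>x. Re (ip x x) \<le> K *
      Re (ip (S (b\<^sup>\<star> \<cdot> b) x + hsmul m x) (S (b\<^sup>\<star> \<cdot> b) x + hsmul m x))" by blast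
qed

section \<open>Nonnegativity of the form on a coset, by elimination of a pivot\<close>

lemma form_nonneg:
  fixes n :: nat
  assumes "\<forall>i<n. proj B (b i) \<in> (+) r ` H"
  shows "0 \<le> (\<Sum>i<n. \<Sum>j<n. ip (S ((b j)\<^sup>\<star> \<cdot> b i) (\<xi> i)) (\<xi> j))"
  using assms
\<comment> \<open>The bundle elements are generalized because the induction hypothesis is applied to
  the \<open>z i\<close>; the vectors stay the same.\<close>
proof (induction n arbitrary: b)
  case 0
  then show ?case by simp
next
  case (Suc n)
  let ?Q = "\<Sum>i<Suc n. \<Sum>j<Suc n. ip (S ((b j)\<^sup>\<star> \<cdot> b i) (\<xi> i)) (\<xi> j)"
  define p x where "p = b n" and "x = \<xi> n"
  define a where "a = p\<^sup>\<star> \<cdot> p"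
  have aH: "proj B a \<in> H" unfolding a_def by (simp add: subgroup_simps)
  have pb: "- proj B p + proj B (b i) \<in> H" "- proj B (b i) + proj B p \<in> H" if "i < n" for i
    using Suc.prems that unfolding p_def by (auto intro!: coset_diff[of _ r])
  have bb: "- proj B (b j) + proj B (b i) \<in> H" if "i < n" "j < n" for i j
    using Suc.prems that by (auto intro!: coset_diff[of _ r])
  have symS: "ip u (S a v) = ip (S a u) v" for u v
    using S_star[OF aH] by (simp add: a_def star_mult)
  \<comment> \<open>Both \<open>d\<close> and \<open>w\<close> depend on \<open>\<mu>\<close>, but
    the bracket has a lower bound that depends only on \<open>x\<close>.\<close>
  have key: "\<exists>d w. d \<ge> 0 \<and> ?Q = d + complex_of_real \<mu> * (2 * ip w w + ip w x + ip x w)"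
    if \<mu>: "\<mu> > 0" for \<mu> :: real
  proof -
    obtain e where e: "proj B e = 0"
      "\<And>x. S a (S e x) + hsmul (1 / \<mu>) (S a x) + hsmul \<mu> (S e x) = 0"
      using resolvent[OF \<mu>, of p] unfolding a_def by metis
    have eH: "proj B e \<in> H" using e(1) by (simp add: subgroup_simps)
    \<comment> \<open>This is \<open>(1 / \<mu> + e) p\<^sup>\<star> b\<^sub>i\<close>, multiplied
      out because the unit fibre may lack a unit.\<close>
    define y where "y i = badd B (bsmul B (1 / \<mu>) (p\<^sup>\<star> \<cdot> b i)) (e \<cdot> (p\<^sup>\<star> \<cdot> b i))" for i
    define z where "z i = diff (b i) (p \<cdot> y i)" for i
    define Y where "Y i = S (y i) (\<xi> i)" for i
    define w where "w = (\<Sum>i<n. Y i)"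
    have projy: "proj B (y i) = - proj B p + proj B (b i)" for i
      using e(1) by (simp add: y_def)
    have projpy: "proj B (p \<cdot> y i) = proj B (b i)" for i
      by (simp add: projy add.assoc[symmetric])
    have projz: "proj B (z i) = proj B (b i)" for i
      unfolding z_def using projpy[of i] by (simp del: proj_simps(1))
    \<comment> \<open>The relation \<open>p\<^sup>\<star> b\<^sub>i = (a + \<mu>) y\<^sub>i\<close>,
      read after applying \<open>S\<close> to \<open>\<xi> i\<close>.\<close>
    have pbi: "S (p\<^sup>\<star> \<cdot> b i) (\<xi> i) = S a (Y i) + hsmul \<mu> (Y i)" if "i < n" for i
    proof -
      let ?g = "S (p\<^sup>\<star> \<cdot> b i) (\<xi> i)"
      have "Y i = hsmul (1 / \<mu>) ?g + S e ?g"
        using e(1) eH pb(1)[OF that] unfolding Y_def y_def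
        by (simp add: S_badd S_bsmul S_mult)
      then have "S a (Y i) + hsmul \<mu> (Y i)
          = ?g + (S a (S e ?g) + hsmul (1 / \<mu>) (S a ?g) + hsmul \<mu> (S e ?g))"
        using \<open>\<mu> > 0\<close> aH by (simp add: S_add S_smul smul_add smul_smul algebra_simps)
      then show ?thesis unfolding e(2) by simp
    qed
    have bip: "ip (S ((b i)\<^sup>\<star> \<cdot> p) u) v = ip u (S (p\<^sup>\<star> \<cdot> b i) v)" if "i < n" for i u v
      using S_star[of "p\<^sup>\<star> \<cdot> b i" u v] pb(1)[OF that] by (simp add: star_mult)
    \<comment> \<open>Expanding \<open>z\<^sub>j\<^sup>\<star> z\<^sub>i\<close>, each of the two
      cross terms contributes \<open>a + \<mu>\<close> between \<open>Y i\<close> and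
      \<open>Y j\<close>, and the term with both \<open>y\<close>s contributes \<open>a\<close>.
      Solving for the entry of the \<open>b\<close>s leaves
      \<open>2 (a + \<mu>) - a = a + 2 \<mu>\<close>.\<close>
    have entry: "ip (S ((b j)\<^sup>\<star> \<cdot> b i) (\<xi> i)) (\<xi> j)
        = ip (S ((z j)\<^sup>\<star> \<cdot> z i) (\<xi> i)) (\<xi> j) + 2 * \<mu> * ip (Y i) (Y j) + ip (S a (Y i)) (Y j)"
      if ij: "i < n" "j < n" for i j
    proof -
      have yH: "proj B (y i) \<in> H" "proj B (y j) \<in> H" "proj B ((y j)\<^sup>\<star>) \<in> H"
        using pb(1) ij subgroup_simps(3)[of "- proj B p + proj B (b j)"] by (auto simp: projy)
      have gH: "proj B (p\<^sup>\<star> \<cdot> b i) \<in> H" "proj B ((b j)\<^sup>\<star> \<cdot> p) \<in> H" "proj B ((b j)\<^sup>\<star> \<cdot> b i) \<in> H"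
        using pb bb ij by auto
      \<comment> \<open>The products are bracketed so that every factor to be represented lies over
        \<open>H\<close>; \<open>p\<close> and the \<open>b i\<close> alone need not.\<close>
      have zz: "(z j)\<^sup>\<star> \<cdot> z i = diff (diff ((b j)\<^sup>\<star> \<cdot> b i) (((b j)\<^sup>\<star> \<cdot> p) \<cdot> y i))
          (diff ((y j)\<^sup>\<star> \<cdot> (p\<^sup>\<star> \<cdot> b i)) ((y j)\<^sup>\<star> \<cdot> (a \<cdot> y i)))"
      proof -
        have "(z j)\<^sup>\<star> \<cdot> z i = diff ((b j)\<^sup>\<star> \<cdot> z i) ((p \<cdot> y j)\<^sup>\<star> \<cdot> z i)"
          unfolding z_def[of j] using projpy[of j]
          by (subst star_diff, simp, subst diff_mult) (simp_all del: proj_simps(1))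
        also have "(b j)\<^sup>\<star> \<cdot> z i = diff ((b j)\<^sup>\<star> \<cdot> b i) ((b j)\<^sup>\<star> \<cdot> (p \<cdot> y i))"
          unfolding z_def[of i] using projpy[of i] by (intro mult_diff) simp
        also have "(p \<cdot> y j)\<^sup>\<star> \<cdot> z i = diff ((p \<cdot> y j)\<^sup>\<star> \<cdot> b i) ((p \<cdot> y j)\<^sup>\<star> \<cdot> (p \<cdot> y i))"
          unfolding z_def[of i] using projpy[of i] by (intro mult_diff) simp
        finally show ?thesis by (simp add: star_mult mult_assoc a_def)
      qed
      have p1: "proj B (((b j)\<^sup>\<star> \<cdot> p) \<cdot> y i) = proj B ((b j)\<^sup>\<star> \<cdot> b i)"
        by (simp add: projy add.assoc)
      have p2: "proj B ((y j)\<^sup>\<star> \<cdot> (p\<^sup>\<star> \<cdot> b i)) = proj B ((b j)\<^sup>\<star> \<cdot> b i)"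
        by (simp add: projy minus_add add.assoc)
      have p3: "proj B ((y j)\<^sup>\<star> \<cdot> (a \<cdot> y i)) = proj B ((b j)\<^sup>\<star> \<cdot> b i)"
        by (simp add: projy minus_add add.assoc a_def)
      note del = proj_simps(1,2)
      have "ip (S ((z j)\<^sup>\<star> \<cdot> z i) (\<xi> i)) (\<xi> j)
          = ip (S ((b j)\<^sup>\<star> \<cdot> b i) (\<xi> i)) (\<xi> j) - ip (S (((b j)\<^sup>\<star> \<cdot> p) \<cdot> y i) (\<xi> i)) (\<xi> j)
            - (ip (S ((y j)\<^sup>\<star> \<cdot> (p\<^sup>\<star> \<cdot> b i)) (\<xi> i)) (\<xi> j) - ip (S ((y j)\<^sup>\<star> \<cdot> (a \<cdot> y i)) (\<xi> i)) (\<xi> j))"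
        unfolding zz using gH(3) by (simp add: ip_S_diff p1 p2 p3 del: del)
      also have "ip (S (((b j)\<^sup>\<star> \<cdot> p) \<cdot> y i) (\<xi> i)) (\<xi> j)
          = ip (Y i) (S a (Y j) + hsmul \<mu> (Y j))"
        using S_mult[OF gH(2) yH(1)] by (simp add: bip ij pbi flip: Y_def)
      also have "ip (S ((y j)\<^sup>\<star> \<cdot> (p\<^sup>\<star> \<cdot> b i)) (\<xi> i)) (\<xi> j)
          = ip (S a (Y i) + hsmul \<mu> (Y i)) (Y j)"
        using S_mult[OF yH(3) gH(1)] S_star[OF yH(2)] by (simp add: ij pbi flip: Y_def)
      also have "ip (S ((y j)\<^sup>\<star> \<cdot> (a \<cdot> y i)) (\<xi> i)) (\<xi> j) = ip (S a (Y i)) (Y j)"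
        using S_mult[OF yH(3), of "a \<cdot> y i"] S_mult[OF aH yH(1)] S_star[OF yH(2)] yH(1)
        by (simp add: Y_def a_def)
      finally show ?thesis
        by (simp add: ip_add_left ip_add_right ip_smul_left ip_smul_right symS algebra_simps)
    qed
    let ?Z = "\<Sum>i<n. \<Sum>j<n. ip (S ((z j)\<^sup>\<star> \<cdot> z i) (\<xi> i)) (\<xi> j)"
    have "0 \<le> ?Z" using Suc.prems by (intro Suc.IH) (simp add: projz)
    moreover have "0 \<le> ip (S a (x + w)) (x + w)" unfolding a_def by (rule S_star_mult_nonneg)
    \<comment> \<open>Completing the square: the old block, the new row and column, and the corner
      \<open>\<langle>S(a) x, x\<rangle>\<close> combine into the form of \<open>S a\<close> at
      \<open>x + w\<close>.\<close>
    moreover have "?Q = ?Z + ip (S a (x + w)) (x + w) + \<mu> * (2 * ip w w + ip w x + ip x w)"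
    proof -
      have "(\<Sum>i<n. \<Sum>j<n. ip (S ((b j)\<^sup>\<star> \<cdot> b i) (\<xi> i)) (\<xi> j))
          = ?Z + 2 * \<mu> * ip w w + ip (S a w) w"
        by (simp add: entry sum.distrib w_def S_sum aH ip_sum_sum sum_distrib_left)
      moreover have "(\<Sum>i<n. ip (S (p\<^sup>\<star> \<cdot> b i) (\<xi> i)) x) = ip (S a w) x + \<mu> * ip w x"
        by (simp add: pbi sum.distrib w_def S_sum aH ip_add_left ip_smul_left ip_sum_left
            sum_distrib_left)
      moreover have "(\<Sum>j<n. ip (S ((b j)\<^sup>\<star> \<cdot> p) x) (\<xi> j)) = ip x (S a w) + \<mu> * ip x w"
        by (simp add: bip pbi sum.distrib w_def S_sum aH ip_add_right ip_smul_right ip_sum_right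
            sum_distrib_left)
      ultimately show ?thesis
        by (simp add: sum.distrib S_add aH ip_add_left ip_add_right symS algebra_simps
            flip: p_def x_def a_def)
    qed
    ultimately show ?thesis
      by (intro exI[of _ "?Z + ip (S a (x + w)) (x + w)"] exI[of _ w]) simp
  qed
  have real: "Im (2 * ip w w + ip w x + ip x w) = 0" for w
    using ip_cnj[of w x] ip_ge_0[of w] by (simp add: less_eq_complex_def)
  \<comment> \<open>The complex order also demands a real value; any \<open>\<mu> > 0\<close> shows
    this, and 1 is chosen.\<close>
  have "Im ?Q = 0"
  proof -
    obtain d w where d: "d \<ge> 0" "?Q = d + complex_of_real 1 * (2 * ip w w + ip w x + ip x w)"
      using key[of 1] by auto
    show ?thesis
      unfolding d(2) using d(1) real[of w] by (simp add: less_eq_complex_def)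
  qed
  moreover have "0 \<le> Re ?Q"
  proof (rule field_le_epsilon)
    fix \<epsilon> :: real assume "\<epsilon> > 0"
    \<comment> \<open>The summand 1 covers the case \<open>x = 0\<close>.\<close>
    define \<mu> where "\<mu> = \<epsilon> / (Re (ip x x) + 1)"
    have \<mu>: "\<mu> > 0" "\<mu> * Re (ip x x) \<le> \<epsilon>"
      using \<open>\<epsilon> > 0\<close> Re_ip_ge_0[of x] unfolding \<mu>_def by (auto simp: field_simps)
    obtain d w where d: "d \<ge> 0"
      "?Q = d + complex_of_real \<mu> * (2 * ip w w + ip w x + ip x w)"
      using key[OF \<mu>(1)] by blast
    \<comment> \<open>Since \<open>x + w\<close> has nonnegative squared norm, the bracket is at
      least \<open>\<langle>w, w\<rangle> - \<langle>x, x\<rangle>\<close>. This bound is cruder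
      than the one with factor 1/2, but enough for the limit.\<close>
    have "- Re (ip x x) \<le> Re (2 * ip w w + ip w x + ip x w)"
      using Re_ip_add_smul[of x 1 w] Re_ip_ge_0[of "x + hsmul (of_real 1) w"] Re_ip_ge_0[of w]
        Re_ip_commute[of x w]
      by simp
    then have "- \<epsilon> \<le> \<mu> * Re (2 * ip w w + ip w x + ip x w)"
      using \<mu> mult_left_mono[of "- Re (ip x x)" "Re (2 * ip w w + ip w x + ip x w)" \<mu>] by simp
    moreover have "Re ?Q = Re d + \<mu> * Re (2 * ip w w + ip w x + ip x w)"
      unfolding d(2) by simp
    ultimately show "0 \<le> Re ?Q + \<epsilon>" using d(1) by (simp add: less_eq_complex_def)
  qed
  ultimately show ?case by (simp add: less_eq_complex_def)
qed

end

theorem theorem2p1: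
  fixes B :: "('g::{topological_group_add, t2_space}, 'b::topological_space) bundle_ops"
    and H :: "'g set"
    and hsmul :: "complex \<Rightarrow> 'x::ab_group_add \<Rightarrow> 'x"
    and ip :: "'x \<Rightarrow> 'x \<Rightarrow> complex"
    and S :: "'b \<Rightarrow> 'x \<Rightarrow> 'x"
  assumes "locally_compact_space (euclidean :: 'g topology)"
    and "fell_bundle B"
    and "closed_subgroup H"
    and "hilbert_space hsmul ip"
    and "reduction_rep B H hsmul ip S"
  shows "B_positive B H ip S"
proof -
  interpret fell_rep hsmul ip B H S
    using assms by unfold_locales
  show ?thesis
    unfolding B_positive_def by (blast intro: form_nonneg)
qed

end
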